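(* Let $r\in\mathbb{R}^2$ be a root, $t_1,\dots,t_n\in\mathbb{R}^2$ terminals, and $0<\alpha<\pi/2$ a restricting angle. Let $T$ be an optimal flux tree and $T'$ an optimal spiral tree for this input. Then $T'$ is a $\sec(\alpha)$-approximation of $T$, i.e., $L(T')\le \sec(\alpha)\,L(T)$, where $L$ denotes length.
   Context: The root $r$ is placed at the origin. A curve directed towards $r$ is angle-restricted if at every point $p\neq r$ of it the angle between the tangent vector of the curve at $p$ (in the direction of travel; one-sided tangents at breakpoints) and the vector from $p$ to $r$ is at most $\alpha$. A flux tree (angle-restricted Steiner arborescence) for root $r$ and terminals $t_1,\dots,t_n$ is a finite tree drawn in the plane, rooted at $r$, whose nodes include $r$ and all terminals and possibly additional (Steiner) nodes, whose arcs are rectifiable curves (piecewise smooth away from $r$) directed from the terminals towards the root, all of them angle-restricted. Its length is the sum of the lengths of its arcs; an optimal flux tree is one of minimum length. For a point $p$ with polar coordinates $(R,\phi)$ the right spiral $\mathcal{S}^+_p$ is given in polar coordinates by $R(t)=Re^{-t}$, $\phi(t)=\phi+\tan(\alpha)\,t$, and the left spiral $\mathcal{S}^-_p$ by the same equations with $\alpha$ replaced by $-\alpha$. A spiral segment is a connected piece of a right or left spiral (possibly including the limit endpoint $r$), directed towards $r$. A spiral tree is a flux tree each of whose arcs is a concatenation of (arbitrarily many) spiral segments; an optimal spiral tree is a spiral tree of minimum length. *)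

theory Defs
  imports "HOL-Analysis.Analysis"
begin

text \<open>
  The plane is the type \<^typ>\<open>complex\<close>; curves are paths, parametrised over \<open>{0..1}\<close> in the
  direction of travel.
\<close>

definition inscribed_lengths :: "(real \<Rightarrow> complex) \<Rightarrow> real set" where
  "inscribed_lengths g =
     {(\<Sum>i<n. dist (g (x i)) (g (x (Suc i)))) | (x :: nat \<Rightarrow> real) (n :: nat).
        (\<forall>i\<le>n. x i \<in> {0..1}) \<and> (\<forall>i<n. x i \<le> x (Suc i))}"

definition rectifiable :: "(real \<Rightarrow> complex) \<Rightarrow> bool" where
  "rectifiable g \<longleftrightarrow> bdd_above (inscribed_lengths g)"

definition path_length :: "(real \<Rightarrow> complex) \<Rightarrow> real" where
  "path_length g = Sup (inscribed_lengths g)"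

text \<open>
  \<open>piecewise P g a b\<close>: there are finitely many breakpoints, \<open>a\<close> and \<open>b\<close> among them, such that
  \<open>g\<close> has property \<open>P\<close> on every closed interval between two consecutive ones.
\<close>

definition piecewise ::
    "((real \<Rightarrow> complex) \<Rightarrow> real \<Rightarrow> real \<Rightarrow> bool) \<Rightarrow> (real \<Rightarrow> complex) \<Rightarrow> real \<Rightarrow> real \<Rightarrow> bool" where
  "piecewise P g a b \<longleftrightarrow>
     (\<exists>S. finite S \<and> {a, b} \<subseteq> S \<and> S \<subseteq> {a..b} \<and>
          (\<forall>c\<in>S. \<forall>d\<in>S. c < d \<and> {c<..<d} \<inter> S = {} \<longrightarrow> P g c d))"

text \<open>
  Smooth means continuously differentiable with non-vanishing velocity, one-sidedly at the two
  ends, so that a piecewise smooth curve has one-sided tangents everywhere.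
\<close>

definition smooth_piece :: "(real \<Rightarrow> complex) \<Rightarrow> real \<Rightarrow> real \<Rightarrow> bool" where
  "smooth_piece g c d \<longleftrightarrow>
     (\<exists>g'. continuous_on {c..d} g' \<and>
           (\<forall>s\<in>{c..d}. (g has_vector_derivative g' s) (at s within {c..d}) \<and> g' s \<noteq> 0))"

definition piecewise_smooth_away_from :: "complex \<Rightarrow> (real \<Rightarrow> complex) \<Rightarrow> bool" where
  "piecewise_smooth_away_from r g \<longleftrightarrow>
     (\<forall>a b. 0 \<le> a \<and> a \<le> b \<and> b \<le> 1 \<and> r \<notin> g ` {a..b} \<longrightarrow> piecewise smooth_piece g a b)"

text \<open>Only meaningful for non-zero vectors.\<close>

definition vec_angle :: "complex \<Rightarrow> complex \<Rightarrow> real" where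
  "vec_angle u v = arccos (inner u v / (norm u * norm v))"

definition angle_restricted :: "real \<Rightarrow> complex \<Rightarrow> (real \<Rightarrow> complex) \<Rightarrow> bool" where
  "angle_restricted \<alpha> r g \<longleftrightarrow>
     (\<forall>s\<in>{0..<1}. \<forall>v. g s \<noteq> r \<and> (g has_vector_derivative v) (at_right s)
         \<longrightarrow> vec_angle v (r - g s) \<le> \<alpha>) \<and>
     (\<forall>s\<in>{0<..1}. \<forall>v. g s \<noteq> r \<and> (g has_vector_derivative v) (at_left s)
         \<longrightarrow> vec_angle v (r - g s) \<le> \<alpha>)"

text \<open>
  A tree drawn in the plane: its nodes are points, its arcs are curves. The drawing may have
  crossings.
\<close>

record plane_tree =
  nodes :: "complex set"
  arcs :: "(real \<Rightarrow> complex) set"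

definition tree_rooted_at :: "complex \<Rightarrow> plane_tree \<Rightarrow> bool" where
  "tree_rooted_at r T \<longleftrightarrow>
     finite (nodes T) \<and> finite (arcs T) \<and> r \<in> nodes T \<and>
     (\<forall>g\<in>arcs T. path g \<and> pathstart g \<in> nodes T \<and> pathfinish g \<in> nodes T) \<and>
     (\<forall>g\<in>arcs T. pathstart g \<noteq> r) \<and>
     (\<forall>v\<in>nodes T - {r}. \<exists>!g. g \<in> arcs T \<and> pathstart g = v) \<and>
     (\<forall>v\<in>nodes T. (v, r) \<in> {(pathstart g, pathfinish g) | g. g \<in> arcs T}\<^sup>*)"

definition tree_length :: "plane_tree \<Rightarrow> real" where
  "tree_length T = (\<Sum>g\<in>arcs T. path_length g)"

definition flux_tree :: "real \<Rightarrow> complex \<Rightarrow> complex set \<Rightarrow> plane_tree \<Rightarrow> bool" where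
  "flux_tree \<alpha> r X T \<longleftrightarrow>
     tree_rooted_at r T \<and> X \<subseteq> nodes T \<and>
     (\<forall>g\<in>arcs T. rectifiable g \<and> piecewise_smooth_away_from r g \<and> angle_restricted \<alpha> r g)"

text \<open>
  The right spiral of \<open>p\<close> is \<open>spiral \<alpha> r p\<close> and the left one is \<open>spiral (- \<alpha>) r p\<close>,
  both restricted to non-negative times.
\<close>

definition spiral :: "real \<Rightarrow> complex \<Rightarrow> complex \<Rightarrow> real \<Rightarrow> complex" where
  "spiral \<beta> r p t = r + of_real (exp (- t)) * cis (tan \<beta> * t) * (p - r)"

text \<open>
  The point at time \<open>d\<close> is not constrained directly: for a path \<open>g\<close> it is determined by continuity,
  and it is the limit endpoint \<open>r\<close> exactly if \<open>\<phi>\<close> is unbounded on \<open>{c..<d}\<close>.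
\<close>

definition spiral_segment ::
    "real \<Rightarrow> complex \<Rightarrow> (real \<Rightarrow> complex) \<Rightarrow> real \<Rightarrow> real \<Rightarrow> bool" where
  "spiral_segment \<alpha> r g c d \<longleftrightarrow>
     (\<exists>p \<beta> \<phi>. p \<noteq> r \<and> \<beta> \<in> {\<alpha>, - \<alpha>} \<and> strict_mono_on {c..<d} \<phi> \<and>
        (\<forall>s\<in>{c..<d}. 0 \<le> \<phi> s \<and> g s = spiral \<beta> r p (\<phi> s)))"

definition spiral_tree :: "real \<Rightarrow> complex \<Rightarrow> complex set \<Rightarrow> plane_tree \<Rightarrow> bool" where
  "spiral_tree \<alpha> r X T \<longleftrightarrow>
     flux_tree \<alpha> r X T \<and> (\<forall>g\<in>arcs T. piecewise (spiral_segment \<alpha> r) g 0 1)"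

definition optimal_flux_tree :: "real \<Rightarrow> complex \<Rightarrow> complex set \<Rightarrow> plane_tree \<Rightarrow> bool" where
  "optimal_flux_tree \<alpha> r X T \<longleftrightarrow>
     flux_tree \<alpha> r X T \<and> (\<forall>U. flux_tree \<alpha> r X U \<longrightarrow> tree_length T \<le> tree_length U)"

definition optimal_spiral_tree :: "real \<Rightarrow> complex \<Rightarrow> complex set \<Rightarrow> plane_tree \<Rightarrow> bool" where
  "optimal_spiral_tree \<alpha> r X T \<longleftrightarrow>
     spiral_tree \<alpha> r X T \<and> (\<forall>U. spiral_tree \<alpha> r X U \<longrightarrow> tree_length T \<le> tree_length U)"

end

theory Submission
  imports Defs
begin

text \<open>
  An angle-restricted arc from \<open>u\<close> to \<open>v\<close> has length at least \<open>\<bar>u - r\<bar> - \<bar>v - r\<bar>\<close>, whereas a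
  concatenation of spiral segments from \<open>u\<close> to \<open>v\<close> has length exactly \<open>sec \<alpha>\<close> times this amount.
  Hence it suffices to replace every arc of the flux tree by such a concatenation with the same
  end points. If \<open>v = r\<close>, one right spiral does. Otherwise the arc avoids \<open>r\<close>, and integrating
  \<open>g' / (g - r)\<close> shows that while the logarithm of the distance to \<open>r\<close> drops by \<open>\<tau>\<close>, the arc turns
  around \<open>r\<close> by at most \<open>\<tau> * tan \<alpha>\<close> in total; so a right spiral followed by a left one, with the
  switching time chosen suitably, leads from \<open>u\<close> to \<open>v\<close>.
\<close>

subsection \<open>Vectors at a restricted angle\<close>

text \<open>Multiplication by \<open>p\<close> is a similarity, so the angle between
  \<open>p * w\<close> and \<open>p\<close> is the argument of \<open>w\<close> up to sign.
  Velocities are therefore written as multiples of the vector towards the root.\<close>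

lemma vec_angle_mult:
  assumes "p \<noteq> 0" "w \<noteq> 0"
  shows "vec_angle (p * w) p = arccos (Re w / norm w)"
proof -
  have "inner (p * w) p = (norm p)\<^sup>2 * Re w"
    unfolding cmod_power2 by (simp add: inner_complex_def algebra_simps power2_eq_square)
  then show ?thesis
    using assms by (simp add: vec_angle_def norm_mult power2_eq_square)
qed

lemma sqrt_one_plus_tan_squared:
  assumes "0 < cos (a::real)"
  shows "sqrt (1 + (tan a)\<^sup>2) = 1 / cos a"
proof -
  have "1 + (tan a)\<^sup>2 = (1 / cos a)\<^sup>2"
    using assms tan_sec[of a] by (simp add: inverse_eq_divide power_divide)
  then show ?thesis
    using assms by (simp add: real_sqrt_divide)
qed

text \<open>\<open>Complex 1 \<sigma>\<close> has real part 1 and modulus sec \<alpha>, so the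
  cosine of the angle is exactly cos \<alpha>; the positive factor \<open>m\<close> only rescales
  the speed.\<close>

lemma vec_angle_spiral_velocity:
  assumes "p \<noteq> 0" "0 < m" "\<bar>\<sigma>\<bar> = tan \<alpha>" "0 < \<alpha>" "\<alpha> < pi / 2"
  shows "vec_angle (p * (of_real m * Complex 1 \<sigma>)) p = \<alpha>"
proof -
  have c: "0 < cos \<alpha>" using assms by (simp add: cos_gt_zero)
  have "\<sigma>\<^sup>2 = (tan \<alpha>)\<^sup>2" using assms(3) by (metis power2_abs)
  then have n: "norm (Complex 1 \<sigma>) = 1 / cos \<alpha>"
    using sqrt_one_plus_tan_squared[OF c] by (simp add: cmod_def)
  have "of_real m * Complex 1 \<sigma> \<noteq> 0" using assms by (simp add: complex_eq_iff)
  then show ?thesis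
    using assms c by (simp add: vec_angle_mult norm_mult n arccos_cos)
qed

subsection \<open>Points reachable by angle-restricted arcs\<close>

lemma has_vector_derivative_exp:
  fixes f :: "real \<Rightarrow> complex"
  assumes "(f has_vector_derivative f') (at s within S)"
  shows "((\<lambda>s. exp (f s)) has_vector_derivative f' * exp (f s)) (at s within S)"
  using field_vector_diff_chain_within[OF assms, of exp "exp (f s)"]
  by (simp add: o_def DERIV_exp has_field_derivative_at_within)

text \<open>\<open>z\<close> is a difference of logarithms of \<open>y - r\<close> and
  \<open>x - r\<close>: \<open>- Re z\<close> is the drop of the log-distance to \<open>r\<close>,
  and \<open>Im z\<close> is the angle turned, full windings included. No branch of the logarithm
  has to be chosen.\<close>

definition spirally_reaches :: "real \<Rightarrow> complex \<Rightarrow> complex \<Rightarrow> complex \<Rightarrow> bool" where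
  "spirally_reaches k r x y \<longleftrightarrow>
     (\<exists>z. y - r = (x - r) * exp z \<and> Re z < 0 \<and> \<bar>Im z\<bar> \<le> - k * Re z)"

text \<open>Logarithms add up, and the cone that confines them is closed under addition.\<close>

lemma spirally_reaches_trans:
  assumes "spirally_reaches k r x y" "spirally_reaches k r y z"
  shows "spirally_reaches k r x z"
proof -
  obtain v w where v: "y - r = (x - r) * exp v" "Re v < 0" "\<bar>Im v\<bar> \<le> - k * Re v"
    and w: "z - r = (y - r) * exp w" "Re w < 0" "\<bar>Im w\<bar> \<le> - k * Re w"
    using assms unfolding spirally_reaches_def by blast
  have "z - r = (x - r) * exp (v + w)"
    using v w by (simp add: exp_add)
  moreover have "\<bar>Im (v + w)\<bar> \<le> - k * Re (v + w)"
    using v w by (simp add: algebra_simps)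
  ultimately show ?thesis
    using v(2) w(2) unfolding spirally_reaches_def by (intro exI[of _ "v + w"]) auto
qed

text \<open>Taking cosines gives cos \<alpha> |w| \<le> Re w for w = v / p. Squaring and using sec^2
  = 1 + tan^2 turns this into the bound on the slope of w.\<close>

lemma cone_of_vec_angle_le:
  assumes "v \<noteq> 0" "p \<noteq> 0" "vec_angle v p \<le> \<alpha>" "0 < \<alpha>" "\<alpha> < pi / 2"
  shows "0 < Re (v / p)" "\<bar>Im (v / p)\<bar> \<le> tan \<alpha> * Re (v / p)"
proof -
  define w where "w = v / p"
  have w: "w \<noteq> 0" "v = p * w" using assms by (auto simp: w_def)
  have c: "0 < cos \<alpha>" using assms by (simp add: cos_gt_zero)
  have x: "\<bar>Re w / norm w\<bar> \<le> 1" using w(1) by (simp add: abs_Re_le_cmod)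
  then have x': "- 1 \<le> Re w / norm w" "Re w / norm w \<le> 1" by linarith+
  have "arccos (Re w / norm w) \<le> \<alpha>"
    using assms(3) vec_angle_mult[OF assms(2) w(1)] w(2) by simp
  then have "cos \<alpha> \<le> cos (arccos (Re w / norm w))"
    using arccos_lbound[OF x'] assms(4,5) pi_gt_zero by (intro cos_monotone_0_pi_le) linarith+
  then have "cos \<alpha> \<le> Re w / norm w"
    using x by (simp add: cos_arccos_abs)
  then have le: "cos \<alpha> * norm w \<le> Re w"
    using w(1) by (simp add: field_simps)
  then show pos: "0 < Re (v / p)"
    using c w(1) unfolding w_def[symmetric]
    by (meson less_le_trans mult_pos_pos zero_less_norm_iff)
  have "norm w \<le> Re w * (1 / cos \<alpha>)" using le c by (simp add: field_simps)
  then have "(norm w)\<^sup>2 \<le> (Re w * (1 / cos \<alpha>))\<^sup>2"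
    by (simp add: power_mono)
  also have "\<dots> = (Re w)\<^sup>2 * (1 + (tan \<alpha>)\<^sup>2)"
    using c tan_sec[of \<alpha>] by (simp add: power_mult_distrib power_divide inverse_eq_divide)
  finally have "(Im w)\<^sup>2 \<le> (tan \<alpha> * Re w)\<^sup>2"
    unfolding cmod_power2 by (simp add: algebra_simps power_mult_distrib)
  moreover have "0 \<le> tan \<alpha> * Re w"
    using pos assms tan_gt_zero[of \<alpha>] by (simp add: w_def)
  ultimately show "\<bar>Im (v / p)\<bar> \<le> tan \<alpha> * Re (v / p)"
    unfolding w_def[symmetric] by (metis abs_le_square_iff abs_of_nonneg)
qed

text \<open>A continuous logarithm of \<open>g - r\<close> along the piece is a primitive of \<open>g' / (g - r)\<close>,
  and the angle restriction confines this integrand to a convex cone.\<close>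

lemma smooth_piece_spirally_reaches:
  assumes "smooth_piece g c d" "c < d" and avoid: "r \<notin> g ` {c..d}"
    and cd: "{c..d} \<subseteq> {0..1}"
    and ang: "angle_restricted \<alpha> r g" and \<alpha>: "0 < \<alpha>" "\<alpha> < pi / 2"
  shows "spirally_reaches (tan \<alpha>) r (g c) (g d)"
proof -
  obtain g' where cont: "continuous_on {c..d} g'"
    and g': "\<And>s. s \<in> {c..d} \<Longrightarrow> (g has_vector_derivative g' s) (at s within {c..d})"
    and nz: "\<And>s. s \<in> {c..d} \<Longrightarrow> g' s \<noteq> 0"
    using assms(1) unfolding smooth_piece_def by blast
  have ne: "g s \<noteq> r" if "s \<in> {c..d}" for s
    using avoid that by auto
  have contg: "continuous_on {c..d} g"
    using g' has_vector_derivative_continuous continuous_on_eq_continuous_within by blast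
  define q where "q = (\<lambda>s. g' s / (g s - r))"
  define w where "w = (\<lambda>s. integral {c..s} q)"
  have contq: "continuous_on {c..d} q"
    unfolding q_def using ne by (intro continuous_intros cont contg) auto
  have w: "(w has_vector_derivative q s) (at s within {c..d})" if "s \<in> {c..d}" for s
    unfolding w_def using integral_has_vector_derivative[OF contq that] .
  have contw: "continuous_on {c..d} w"
    using w has_vector_derivative_continuous continuous_on_eq_continuous_within by blast
  \<comment> \<open>This product is constant on the piece, which identifies \<open>exp (w s)\<close>
    with (g s - r) / (g c - r).\<close>
  have "((\<lambda>s. (g s - r) * exp (- w s)) has_derivative (\<lambda>h. 0)) (at s within {c..d})"
    if s: "s \<in> {c..d}" for s
  proof -
    have e: "((\<lambda>s. exp (- w s)) has_vector_derivative (- q s) * exp (- w s)) (at s within {c..d})"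
      by (intro has_vector_derivative_exp has_vector_derivative_minus w[OF s])
    have "((\<lambda>s. (g s - r) * exp (- w s)) has_vector_derivative
        (g s - r) * ((- q s) * exp (- w s)) + (g' s - 0) * exp (- w s)) (at s within {c..d})"
      by (intro has_vector_derivative_mult e has_vector_derivative_diff g'[OF s] has_vector_derivative_const)
    moreover have "(g s - r) * ((- q s) * exp (- w s)) + (g' s - 0) * exp (- w s) = 0"
      using ne[OF s] by (simp add: q_def)
    ultimately show ?thesis
      by (simp add: has_vector_derivative_def)
  qed
  then obtain K where K: "\<And>s. s \<in> {c..d} \<Longrightarrow> (g s - r) * exp (- w s) = K"
    using has_derivative_zero_constant[of "{c..d}" "\<lambda>s. (g s - r) * exp (- w s)"] by auto
  have w0: "w c = 0" by (simp add: w_def)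
  have "(g d - r) * exp (- w d) = g c - r"
    using K[of c] K[of d] \<open>c < d\<close> w0 by simp
  then have eq: "g d - r = (g c - r) * exp (w d)"
    by (metis exp_minus_inverse mult.assoc mult.commute mult.right_neutral)
  \<comment> \<open>The angle is measured against \<open>r - g s\<close>, while \<open>q\<close> has
    the denominator \<open>g s - r\<close>; hence the signs. In the interior of the piece the right
    derivative of \<open>g\<close> is \<open>g'\<close>.\<close>
  have cone: "Re (q s) < 0" "\<bar>Im (q s)\<bar> \<le> - tan \<alpha> * Re (q s)" if s: "s \<in> {c<..<d}" for s
  proof -
    have s': "s \<in> {c..d}" using s by auto
    have "(g has_vector_derivative g' s) (at_right s)"
      using g'[OF s'] s by (simp add: at_within_Icc_at has_vector_derivative_at_within)
    then have "vec_angle (g' s) (r - g s) \<le> \<alpha>"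
      using ang ne[OF s'] s cd unfolding angle_restricted_def by force
    then have "0 < Re (g' s / (r - g s))" "\<bar>Im (g' s / (r - g s))\<bar> \<le> tan \<alpha> * Re (g' s / (r - g s))"
      using cone_of_vec_angle_le[of "g' s" "r - g s"] nz[OF s'] ne[OF s'] \<alpha> by auto
    moreover have "g' s / (r - g s) = - q s"
      unfolding q_def by (metis minus_diff_eq minus_divide_right)
    ultimately show "Re (q s) < 0" "\<bar>Im (q s)\<bar> \<le> - tan \<alpha> * Re (q s)" by auto
  qed
  have dw: "(w has_vector_derivative q s) (at s)" if "s \<in> {c<..<d}" for s
    using w[of s] that by (simp add: at_within_Icc_at)
  have dRe: "((\<lambda>s. Re (w s)) has_real_derivative Re (q s)) (at s)"
    and dIm: "((\<lambda>s. Im (w s)) has_real_derivative Im (q s)) (at s)" if "s \<in> {c<..<d}" for s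
    unfolding has_real_derivative_iff_has_vector_derivative
    using bounded_linear.has_vector_derivative[OF bounded_linear_Re dw[OF that]]
      bounded_linear.has_vector_derivative[OF bounded_linear_Im dw[OF that]] by auto
  have "Re (w d) < Re (w c)"
    using cone dRe by (intro DERIV_neg_imp_decreasing_open[OF \<open>c < d\<close>] continuous_intros contw) fastforce
  \<comment> \<open>The cone is cut out by two linear functionals, one for each sign \<epsilon>.
    Each is nonincreasing along \<open>w\<close>, and together they bound the absolute value of
    \<open>Im (w d)\<close>.\<close>
  moreover have "tan \<alpha> * Re (w d) + \<epsilon> * Im (w d) \<le> tan \<alpha> * Re (w c) + \<epsilon> * Im (w c)"
    if "\<epsilon> \<in> {1, -1}" for \<epsilon>
  proof (rule DERIV_nonpos_imp_decreasing_open[of c d "\<lambda>s. tan \<alpha> * Re (w s) + \<epsilon> * Im (w s)"])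
    show "\<exists>y. ((\<lambda>s. tan \<alpha> * Re (w s) + \<epsilon> * Im (w s)) has_real_derivative y) (at s) \<and> y \<le> 0"
      if "c < s" "s < d" for s
    proof (intro exI conjI)
      show "((\<lambda>s. tan \<alpha> * Re (w s) + \<epsilon> * Im (w s)) has_real_derivative
          tan \<alpha> * Re (q s) + \<epsilon> * Im (q s)) (at s)"
        using that by (intro DERIV_add DERIV_cmult dRe dIm) auto
      show "tan \<alpha> * Re (q s) + \<epsilon> * Im (q s) \<le> 0"
        using cone(2)[of s] that \<open>\<epsilon> \<in> {1, -1}\<close> by auto
    qed
  qed (use \<open>c < d\<close> in \<open>auto intro!: continuous_intros contw\<close>)
  from this[of 1] this[of "-1"] have "\<bar>Im (w d)\<bar> \<le> - tan \<alpha> * Re (w d)"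
    using w0 by auto
  ultimately show ?thesis
    using eq w0 unfolding spirally_reaches_def by (intro exI[of _ "w d"]) simp
qed

text \<open>Induction on the number of breakpoints to the left of \<open>d\<close>: go to the
  breakpoint \<open>c\<close> just before \<open>d\<close>, then take one step across the
  gap.\<close>

lemma piecewise_chain:
  assumes "piecewise P g a b" "a < b"
    and step: "\<And>c d. a \<le> c \<Longrightarrow> c < d \<Longrightarrow> d \<le> b \<Longrightarrow> P g c d \<Longrightarrow> R (g c) (g d)"
    and trans: "\<And>x y z. R x y \<Longrightarrow> R y z \<Longrightarrow> R x z"
  shows "R (g a) (g b)"
proof -
  obtain S where S: "finite S" "{a, b} \<subseteq> S" "S \<subseteq> {a..b}"
    and P: "\<forall>c\<in>S. \<forall>d\<in>S. c < d \<and> {c<..<d} \<inter> S = {} \<longrightarrow> P g c d"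
    using assms(1) unfolding piecewise_def by metis
  have "R (g a) (g d)" if "d \<in> S" "a < d" for d
    using that
  proof (induction "card ({..<d} \<inter> S)" arbitrary: d rule: less_induct)
    case less
    define c where "c = Max ({..<d} \<inter> S)"
    have fin: "finite ({..<d} \<inter> S)" "{..<d} \<inter> S \<noteq> {}"
      using S less.prems by auto
    then have c: "c \<in> S" "c < d"
      using Max_in[OF fin] by (auto simp: c_def)
    have gap: "{c<..<d} \<inter> S = {}"
      using Max_ge[OF fin(1)] by (force simp: c_def)
    have bd: "a \<le> c" "d \<le> b" using S(3) c less.prems by auto
    have cd: "R (g c) (g d)"
      using P c less.prems(1) gap by (intro step[OF bd(1) c(2) bd(2)]) simp
    show ?case
    proof (cases "a = c")
      case False
      then have "card ({..<c} \<inter> S) < card ({..<d} \<inter> S)"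
        using c fin by (intro psubset_card_mono) auto
      then have "R (g a) (g c)" using less.hyps c bd False by auto
      then show ?thesis using cd trans by blast
    qed (use cd in simp)
  qed
  then show ?thesis using S \<open>a < b\<close> by auto
qed

text \<open>Smoothness is given only away from \<open>r\<close>, so the arc must first be shown to
  avoid \<open>r\<close>. It does, because the distance to \<open>r\<close> shrinks wherever the arc
  stays off \<open>r\<close>: having met \<open>r\<close>, it could not end elsewhere.\<close>

lemma arc_spirally_reaches:
  assumes "path g" "piecewise_smooth_away_from r g" "angle_restricted \<alpha> r g"
    and \<alpha>: "0 < \<alpha>" "\<alpha> < pi / 2" and "pathfinish g \<noteq> r"
  shows "spirally_reaches (tan \<alpha>) r (pathstart g) (pathfinish g)"
proof -
  have reach: "spirally_reaches (tan \<alpha>) r (g a) (g 1)"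
    if a: "0 \<le> a" "a < 1" and avoid: "r \<notin> g ` {a..1}" for a
  proof (rule piecewise_chain[of smooth_piece g a 1])
    show "piecewise smooth_piece g a 1"
      using assms(2) a avoid unfolding piecewise_smooth_away_from_def by auto
    show "spirally_reaches (tan \<alpha>) r (g c) (g d)"
      if "a \<le> c" "c < d" "d \<le> 1" "smooth_piece g c d" for c d
      using that a avoid assms by (intro smooth_piece_spirally_reaches) auto
  qed (use a spirally_reaches_trans in auto)
  have "r \<notin> g ` {0..1}"
  proof
    assume "r \<in> g ` {0..1}"
    \<comment> \<open>\<open>b\<close> is the last visit to \<open>r\<close>. At every time after
      \<open>b\<close> the distance to \<open>r\<close> is at least that of the end point, which is
      positive; by continuity this also holds at \<open>b\<close>, a contradiction.\<close>
    define Z where "Z = {s \<in> {0..1}. g s = r}"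
    define b where "b = Sup Z"
    have cg: "continuous_on {0..1} g"
      using assms(1) by (simp add: path_def)
    then have "closed Z"
      unfolding Z_def by (intro continuous_closed_preimage_constant) auto
    moreover have Z: "Z \<noteq> {}" "bdd_above Z"
      using \<open>r \<in> g ` {0..1}\<close> by (auto simp: Z_def)
    ultimately have "b \<in> Z"
      unfolding b_def using closed_contains_Sup by blast
    then have b: "0 \<le> b" "b \<le> 1" "g b = r" by (auto simp: Z_def)
    then have "b < 1" using assms(6) by (cases "b = 1") (auto simp: pathfinish_def)
    have le: "norm (g 1 - r) \<le> norm (g a - r)" if a: "b < a" "a < 1" for a
    proof -
      have "r \<notin> g ` {a..1}"
      proof
        assume "r \<in> g ` {a..1}"
        then obtain s where "s \<in> Z" "a \<le> s"
          using a b by (auto simp: Z_def)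
        then show False
          using cSup_upper[of s Z] Z a by (simp add: b_def)
      qed
      then have "spirally_reaches (tan \<alpha>) r (g a) (g 1)"
        using reach a b by auto
      then show ?thesis
        by (auto simp: spirally_reaches_def norm_mult intro!: mult_left_le)
    qed
    have "((\<lambda>s. norm (g s - r)) \<longlongrightarrow> norm (g b - r)) (at b within {b..1})"
      using continuous_on_subset[OF cg, of "{b..1}"] b \<open>b < 1\<close>
      by (intro tendsto_intros) (auto simp: continuous_on_def)
    then have "((\<lambda>s. norm (g s - r)) \<longlongrightarrow> norm (g b - r)) (at_right b)"
      using \<open>b < 1\<close> by (simp add: at_within_Icc_at_right)
    moreover have "eventually (\<lambda>s. norm (g 1 - r) \<le> norm (g s - r)) (at_right b)"
      using eventually_at_right[OF \<open>b < 1\<close>] le \<open>b < 1\<close> by blast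
    ultimately have "norm (g 1 - r) \<le> norm (g b - r)"
      by (intro tendsto_lowerbound) auto
    then show False using b assms(6) by (simp add: pathfinish_def)
  qed
  then show ?thesis
    using reach[of 0] by (simp add: pathstart_def pathfinish_def)
qed

subsection \<open>Length of curves\<close>

lemma dist_endpoints_le_path_length:
  assumes "rectifiable g"
  shows "dist (pathstart g) (pathfinish g) \<le> path_length g"
  unfolding path_length_def
proof (rule cSup_upper)
  define x where "x = (\<lambda>i::nat. if i = 0 then 0 else 1 :: real)"
  have "dist (pathstart g) (pathfinish g) = (\<Sum>i<1. dist (g (x i)) (g (x (Suc i))))"
    by (simp add: x_def pathstart_def pathfinish_def)
  moreover have "(\<forall>i\<le>1::nat. x i \<in> {0..1}) \<and> (\<forall>i<1. x i \<le> x (Suc i))"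
    by (simp add: x_def)
  ultimately show "dist (pathstart g) (pathfinish g) \<in> inscribed_lengths g"
    unfolding inscribed_lengths_def by blast
qed (use assms in \<open>simp add: rectifiable_def\<close>)

text \<open>Inscribed sums telescope under the potential \<open>D\<close>. For spiral arcs
  \<open>D\<close> will be sec \<alpha> times the distance to \<open>r\<close>.\<close>

lemma path_length_le_of_dist_le:
  assumes D: "\<And>a b. 0 \<le> a \<Longrightarrow> a \<le> b \<Longrightarrow> b \<le> 1 \<Longrightarrow> dist (g a) (g b) \<le> D a - D b"
  shows "rectifiable g" "path_length g \<le> D 0 - D 1"
proof -
  have anti: "D b \<le> D a" if "0 \<le> a" "a \<le> b" "b \<le> 1" for a b
    using D[OF that] zero_le_dist[of "g a" "g b"] by linarith
  have bound: "l \<le> D 0 - D 1" if "l \<in> inscribed_lengths g" for l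
  proof -
    obtain x and n :: nat where l: "l = (\<Sum>i<n. dist (g (x i)) (g (x (Suc i))))"
      and x: "\<And>i. i \<le> n \<Longrightarrow> x i \<in> {0..1}" "\<And>i. i < n \<Longrightarrow> x i \<le> x (Suc i)"
      using \<open>l \<in> inscribed_lengths g\<close> unfolding inscribed_lengths_def by blast
    have "l \<le> (\<Sum>i<n. D (x i) - D (x (Suc i)))"
      unfolding l using x by (intro sum_mono D) (auto simp: Suc_le_eq)
    also have "\<dots> = D (x 0) - D (x n)" by (rule sum_lessThan_telescope')
    also have "\<dots> \<le> D 0 - D 1"
      using x(1)[of 0] x(1)[of n] anti[of 0 "x 0"] anti[of "x n" 1] by auto
    finally show ?thesis .
  qed
  then show "rectifiable g" by (auto simp: rectifiable_def bdd_above_def)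
  \<comment> \<open>The empty sum shows that the set of inscribed lengths is nonempty, as
    \<open>cSup_least\<close> requires.\<close>
  have "(\<Sum>i<0. dist (g 0) (g 0)) \<in> inscribed_lengths g"
    unfolding inscribed_lengths_def by (intro CollectI exI[of _ "\<lambda>_. 0"] exI[of _ 0]) auto
  then show "path_length g \<le> D 0 - D 1"
    unfolding path_length_def by (intro cSup_least bound) auto
qed

subsection \<open>Curves of logarithmic spiral type\<close>

text \<open>One fixed set \<open>B\<close> serves every interval from \<open>a\<close> to
  \<open>b\<close>, as suits \<open>piecewise_smooth_away_from\<close>, which quantifies over all of
  them.\<close>

lemma piecewise_of_breakpoints:
  assumes "finite B" "a \<le> b"
    and "\<And>c d. a \<le> c \<Longrightarrow> c < d \<Longrightarrow> d \<le> b \<Longrightarrow> {c<..<d} \<inter> B = {} \<Longrightarrow> P g c d"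
  shows "piecewise P g a b"
  unfolding piecewise_def
proof (intro exI[of _ "{a, b} \<union> (B \<inter> {a..b})"] conjI ballI impI)
  fix c d
  assume c: "c \<in> {a, b} \<union> (B \<inter> {a..b})" and d: "d \<in> {a, b} \<union> (B \<inter> {a..b})"
    and gap: "c < d \<and> {c<..<d} \<inter> ({a, b} \<union> (B \<inter> {a..b})) = {}"
  have "a \<le> c" "d \<le> b" using c d assms(2) by auto
  moreover have "{c<..<d} \<inter> B = {}"
  proof -
    have "{c<..<d} \<subseteq> {a..b}" using \<open>a \<le> c\<close> \<open>d \<le> b\<close> by auto
    then show ?thesis using gap by blast
  qed
  ultimately show "P g c d" using assms(3) gap by blast
qed (use assms(1,2) in auto)

text \<open>For one-sided tangents: next to \<open>s\<close> there is an interval free of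
  breakpoints, even if \<open>s\<close> is itself a breakpoint.\<close>

lemma ex_gap_right:
  fixes s :: real
  assumes "finite B" "s < b"
  shows "\<exists>d. s < d \<and> d < b \<and> {s<..<d} \<inter> B = {}"
proof -
  have "eventually (\<lambda>x. x \<notin> B - {s}) (at_right s)"
  proof -
    have "closed (B - {s})" using assms by (intro finite_imp_closed) auto
    then have "eventually (\<lambda>x. x \<in> - (B - {s})) (nhds s)"
      by (intro eventually_nhds_in_open open_Compl) auto
    then show ?thesis
      by (auto simp: eventually_at_filter elim: eventually_mono)
  qed
  then obtain e where e: "s < e" "\<And>x. s < x \<Longrightarrow> x < e \<Longrightarrow> x \<notin> B - {s}"
    using eventually_at_right[OF assms(2)] by auto
  obtain d where "s < d" "d < min e b" using dense[of s "min e b"] e(1) assms(2) by auto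
  then show ?thesis using e(2) by (intro exI[of _ d]) force
qed

lemma ex_gap_left:
  fixes s :: real
  assumes "finite B" "a < s"
  shows "\<exists>c. a < c \<and> c < s \<and> {c<..<s} \<inter> B = {}"
proof -
  obtain d where d: "- s < d" "d < - a" "{- s<..<d} \<inter> uminus ` B = {}"
    using ex_gap_right[of "uminus ` B" "- s" "- a"] assms by auto
  have "{- d<..<s} \<inter> B = {}"
  proof (rule ccontr)
    assume "{- d<..<s} \<inter> B \<noteq> {}"
    then obtain x where "- d < x" "x < s" "x \<in> B" by auto
    then have "- x \<in> {- s<..<d} \<inter> uminus ` B" by auto
    then show False using d(3) by blast
  qed
  then show ?thesis using d by (intro exI[of _ "- d"]) auto
qed

text \<open>The gradient of the norm at \<open>h s - r\<close> is the unit vector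
  \<open>sgn (h s - r)\<close>, so only the component of the velocity along it, given by
  \<open>Re w\<close>, counts.\<close>

lemma norm_diff_has_real_derivative:
  fixes h :: "real \<Rightarrow> complex"
  assumes "(h has_vector_derivative (r - h s) * w) (at s)" "h s \<noteq> r"
  shows "((\<lambda>s. norm (h s - r)) has_real_derivative - Re w * norm (h s - r)) (at s)"
proof -
  define p where "p = h s - r"
  have p: "p \<noteq> 0" using assms(2) by (simp add: p_def)
  have "((\<lambda>s. h s - r) has_derivative (\<lambda>t. t *\<^sub>R ((r - h s) * w))) (at s)"
    using assms(1) unfolding has_vector_derivative_def
    by (auto intro!: derivative_eq_intros)
  from has_derivative_compose[OF this has_derivative_norm] p
  have "((\<lambda>s. norm (h s - r)) has_derivative
      (\<lambda>t. inner (sgn p) (t *\<^sub>R ((r - h s) * w)))) (at s)"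
    by (simp add: p_def inner_commute)
  moreover have "inner (sgn p) ((r - h s) * w) = - Re w * norm p"
  proof -
    have "r - h s = - p" by (simp add: p_def)
    have "inner p (p * w) = (norm p)\<^sup>2 * Re w"
      unfolding cmod_power2 by (simp add: inner_complex_def algebra_simps power2_eq_square)
    then show ?thesis
      using p unfolding \<open>r - h s = - p\<close>
      by (simp add: sgn_div_norm power2_eq_square field_simps)
  qed
  ultimately show ?thesis
    unfolding has_real_derivative_iff_has_vector_derivative has_vector_derivative_def
    by (simp add: p_def)
qed

text \<open>The radial speed of a curve meeting the rays from \<open>r\<close> at angle \<open>\<alpha>\<close> is \<open>cos \<alpha>\<close> times its
  speed.\<close>

lemma spiral_velocity_dist_le:
  assumes "c \<le> d" "continuous_on {c..d} h" and cos: "0 < cos \<alpha>"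
    and vel: "\<And>s. c < s \<Longrightarrow> s < d \<Longrightarrow> h s \<noteq> r \<and>
      (\<exists>\<sigma> m. \<bar>\<sigma>\<bar> = tan \<alpha> \<and> 0 < m \<and>
        (h has_vector_derivative (r - h s) * (of_real m * Complex 1 \<sigma>)) (at s))"
  shows "dist (h c) (h d) \<le> 1 / cos \<alpha> * norm (h c - r) - 1 / cos \<alpha> * norm (h d - r)"
proof (cases "c = d")
  case False
  then have "c < d" using assms(1) by simp
  have "\<exists>w. (h has_vector_derivative (r - h s) * w) (at s) \<and> norm w \<le> 1 / cos \<alpha> * Re w"
    if s: "s \<in> {c<..<d}" for s
  proof -
    obtain \<sigma> m where \<sigma>: "\<bar>\<sigma>\<bar> = tan \<alpha>" "0 < m"
      "(h has_vector_derivative (r - h s) * (of_real m * Complex 1 \<sigma>)) (at s)"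
      using vel[of s] s by auto
    have "\<sigma>\<^sup>2 = (tan \<alpha>)\<^sup>2" using \<sigma>(1) by (metis power2_abs)
    then have "norm (Complex 1 \<sigma>) = 1 / cos \<alpha>"
      using sqrt_one_plus_tan_squared[OF cos] by (simp add: cmod_def)
    then have "norm (of_real m * Complex 1 \<sigma>) \<le> 1 / cos \<alpha> * Re (of_real m * Complex 1 \<sigma>)"
      using \<sigma>(2) by (simp add: norm_mult)
    then show ?thesis using \<sigma>(3) by blast
  qed
  then obtain w where w: "\<And>s. s \<in> {c<..<d} \<Longrightarrow> (h has_vector_derivative (r - h s) * w s) (at s)"
    "\<And>s. s \<in> {c<..<d} \<Longrightarrow> norm (w s) \<le> 1 / cos \<alpha> * Re (w s)"
    by metis
  \<comment> \<open>The derivative of \<open>D\<close> dominates the speed of \<open>h\<close>, so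
    the mean value inequality bounds the displacement of \<open>h\<close> by the increase of
    \<open>D\<close>.\<close>
  define D where "D = (\<lambda>s. - (1 / cos \<alpha>) * norm (h s - r))"
  have "norm (h d - h c) \<le> D d - D c"
  proof (rule differentiable_bound_general[OF \<open>c < d\<close>])
    fix s assume "c < s" "s < d"
    then have s: "s \<in> {c<..<d}" by simp
    show "(h has_vector_derivative (r - h s) * w s) (at s)"
      by (rule w(1)[OF s])
    have "((\<lambda>s. norm (h s - r)) has_real_derivative - Re (w s) * norm (h s - r)) (at s)"
      using vel[of s] s by (intro norm_diff_has_real_derivative w(1)) auto
    then show "(D has_vector_derivative - (1 / cos \<alpha>) * (- Re (w s) * norm (h s - r))) (at s)"
      unfolding D_def has_real_derivative_iff_has_vector_derivative[symmetric]
      by (rule DERIV_cmult)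
    show "norm ((r - h s) * w s) \<le> - (1 / cos \<alpha>) * (- Re (w s) * norm (h s - r))"
      using mult_right_mono[OF w(2)[OF s] norm_ge_zero[of "h s - r"]]
      by (simp add: norm_mult norm_minus_commute mult.commute)
  qed (use cos in \<open>auto simp: D_def intro!: continuous_intros assms(2)\<close>)
  then show ?thesis by (simp add: D_def dist_norm norm_minus_commute)
qed simp

text \<open>All that \<open>spiral_tree\<close> asks of a single arc, apart from its end
  points.\<close>

definition spiral_arc :: "real \<Rightarrow> complex \<Rightarrow> (real \<Rightarrow> complex) \<Rightarrow> bool" where
  "spiral_arc \<alpha> r h \<longleftrightarrow> path h \<and> rectifiable h \<and> piecewise_smooth_away_from r h \<and>
     angle_restricted \<alpha> r h \<and> piecewise (spiral_segment \<alpha> r) h 0 1"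

text \<open>\<open>m\<close> is the rate at which the log-distance to \<open>r\<close> falls and
  \<open>\<sigma>\<close> tells right from left; \<open>B\<close> contains the times where
  \<open>\<sigma>\<close> may switch. The velocity condition leaves out intervals ending at
  \<open>r\<close>, since there \<open>m\<close> may blow up.\<close>

lemma spiral_arcI:
  assumes \<alpha>: "0 < \<alpha>" "\<alpha> < pi / 2" and B: "finite B" and h: "path h"
    and ne: "\<And>s. 0 \<le> s \<Longrightarrow> s < 1 \<Longrightarrow> h s \<noteq> r"
    and vel: "\<And>c d. 0 \<le> c \<Longrightarrow> c < d \<Longrightarrow> d \<le> 1 \<Longrightarrow> {c<..<d} \<inter> B = {} \<Longrightarrow> h d \<noteq> r \<Longrightarrow>
      \<exists>\<sigma> m. \<bar>\<sigma>\<bar> = tan \<alpha> \<and> continuous_on {c..d} m \<and> (\<forall>s\<in>{c..d}. 0 < m s \<and>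
        (h has_vector_derivative (r - h s) * (of_real (m s) * Complex 1 \<sigma>)) (at s within {c..d}))"
    and seg: "\<And>c d. 0 \<le> c \<Longrightarrow> c < d \<Longrightarrow> d \<le> 1 \<Longrightarrow> {c<..<d} \<inter> B = {} \<Longrightarrow> spiral_segment \<alpha> r h c d"
  shows "spiral_arc \<alpha> r h"
    and "path_length h \<le> 1 / cos \<alpha> * (norm (pathstart h - r) - norm (pathfinish h - r))"
proof -
  have cos: "0 < cos \<alpha>" using \<alpha> by (simp add: cos_gt_zero)
  have conth: "continuous_on {0..1} h" using h by (simp add: path_def)
  have ang: "vec_angle v (r - h s) \<le> \<alpha>"
    if s: "0 \<le> c" "c < d" "d \<le> 1" "{c<..<d} \<inter> B = {}" "h d \<noteq> r" "s \<in> {c..d}" "h s \<noteq> r"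
      and v: "(h has_vector_derivative v) (at s within {c..d})" for c d s v
  proof -
    obtain \<sigma> m where "\<bar>\<sigma>\<bar> = tan \<alpha>" "0 < m s"
      "(h has_vector_derivative (r - h s) * (of_real (m s) * Complex 1 \<sigma>)) (at s within {c..d})"
      using vel[OF s(1-5)] s(6) by blast
    moreover from this have "v = (r - h s) * (of_real (m s) * Complex 1 \<sigma>)"
      using vector_derivative_unique_within_closed_interval[of c d s h v] s v by auto
    ultimately show ?thesis
      using vec_angle_spiral_velocity[of "r - h s" "m s" \<sigma> \<alpha>] \<alpha> s(7) by simp
  qed
  have "angle_restricted \<alpha> r h"
    unfolding angle_restricted_def
  proof (intro conjI ballI allI impI)
    fix s v assume s: "s \<in> {0..<1::real}" and v: "h s \<noteq> r \<and> (h has_vector_derivative v) (at_right s)"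
    obtain d where d: "s < d" "d < 1" "{s<..<d} \<inter> B = {}"
      using ex_gap_right[OF B, of s 1] s by auto
    show "vec_angle v (r - h s) \<le> \<alpha>"
      using s d v ne[of d] by (intro ang[of s d s]) (auto simp: at_within_Icc_at_right)
  next
    fix s v assume s: "s \<in> {0<..1::real}" and v: "h s \<noteq> r \<and> (h has_vector_derivative v) (at_left s)"
    obtain c where c: "0 < c" "c < s" "{c<..<s} \<inter> B = {}"
      using ex_gap_left[OF B, of 0 s] s by auto
    show "vec_angle v (r - h s) \<le> \<alpha>"
      using s c v by (intro ang[of c s s]) (auto simp: at_within_Icc_at_left)
  qed
  moreover have "piecewise_smooth_away_from r h"
    unfolding piecewise_smooth_away_from_def
  proof (intro allI impI, elim conjE)
    fix a b :: real assume ab: "0 \<le> a" "a \<le> b" "b \<le> 1" and avoid: "r \<notin> h ` {a..b}"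
    show "piecewise smooth_piece h a b"
    proof (rule piecewise_of_breakpoints[OF B ab(2)])
      fix c d assume cd: "a \<le> c" "c < d" "d \<le> b" "{c<..<d} \<inter> B = {}"
      have ne': "h s \<noteq> r" if "s \<in> {c..d}" for s
        using avoid that cd by (metis atLeastAtMost_iff image_eqI order_trans)
      have "0 \<le> c" "d \<le> 1" using cd ab by auto
      then obtain \<sigma> m where m: "continuous_on {c..d} m" "\<And>s. s \<in> {c..d} \<Longrightarrow> 0 < m s"
        "\<And>s. s \<in> {c..d} \<Longrightarrow>
          (h has_vector_derivative (r - h s) * (of_real (m s) * Complex 1 \<sigma>)) (at s within {c..d})"
        using vel[of c d] cd ne'[of d] by (metis atLeastAtMost_iff less_imp_le order_refl)
      have "continuous_on {c..d} h"
        using conth by (rule continuous_on_subset) (use \<open>0 \<le> c\<close> \<open>d \<le> 1\<close> in auto)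
      then have "continuous_on {c..d} (\<lambda>s. (r - h s) * (of_real (m s) * Complex 1 \<sigma>))"
        by (intro continuous_intros m(1))
      moreover have "(r - h s) * (of_real (m s) * Complex 1 \<sigma>) \<noteq> 0" if "s \<in> {c..d}" for s
      proof -
        have "Complex 1 \<sigma> \<noteq> 0" by (simp add: complex_eq_iff)
        then show ?thesis using ne'[OF that] m(2)[OF that] by simp
      qed
      ultimately show "smooth_piece h c d"
        unfolding smooth_piece_def using m(3)
        by (intro exI[of _ "\<lambda>s. (r - h s) * (of_real (m s) * Complex 1 \<sigma>)"]) simp
    qed
  qed
  moreover have "piecewise (spiral_segment \<alpha> r) h 0 1"
    using seg by (intro piecewise_of_breakpoints[OF B]) auto
  moreover have dist: "dist (h a) (h b) \<le> 1 / cos \<alpha> * norm (h a - r) - 1 / cos \<alpha> * norm (h b - r)"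
    if ab: "0 \<le> a" "a \<le> b" "b \<le> 1" for a b
  proof (cases "a = b")
    case False
    \<comment> \<open>This relation is transitive: the triangle inequality handles the left side,
      and the right side telescopes. So it need only be shown between breakpoints.\<close>
    let ?R = "\<lambda>x y. dist x y \<le> 1 / cos \<alpha> * norm (x - r) - 1 / cos \<alpha> * norm (y - r)"
    let ?P = "\<lambda>g c d. ?R (g c) (g d)"
    have "piecewise ?P h a b"
    proof (rule piecewise_of_breakpoints[OF B ab(2)])
      fix c d assume cd: "a \<le> c" "c < d" "d \<le> b" "{c<..<d} \<inter> B = {}"
      show "?R (h c) (h d)"
      proof (rule spiral_velocity_dist_le[OF _ _ cos])
        show "continuous_on {c..d} h"
          using conth by (rule continuous_on_subset) (use ab cd in auto)
        fix s assume s: "c < s" "s < d"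
        \<comment> \<open>\<open>vel\<close> says nothing if \<open>h d = r\<close>. Shortening the
          interval to end at \<open>e < 1\<close> avoids this while keeping \<open>s\<close> in its
          interior.\<close>
        define e where "e = (s + d) / 2"
        have e: "s < e" "e < d" using s by (auto simp: e_def)
        have "{c<..<e} \<subseteq> {c<..<d}" using e by auto
        then have "0 \<le> c" "c < e" "e < 1" "{c<..<e} \<inter> B = {}" using s e ab cd by auto
        then obtain \<sigma> m where "\<bar>\<sigma>\<bar> = tan \<alpha>" "0 < m s"
          "(h has_vector_derivative (r - h s) * (of_real (m s) * Complex 1 \<sigma>)) (at s within {c..e})"
          using vel[of c e] ne[of e] s e by (metis atLeastAtMost_iff less_imp_le order_trans)
        moreover have "at s within {c..e} = at s" using s e by (simp add: at_within_Icc_at)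
        ultimately show "h s \<noteq> r \<and> (\<exists>\<sigma> m. \<bar>\<sigma>\<bar> = tan \<alpha> \<and> 0 < m \<and>
            (h has_vector_derivative (r - h s) * (of_real m * Complex 1 \<sigma>)) (at s))"
          using ne[of s] s e \<open>e < 1\<close> \<open>0 \<le> c\<close> by auto
      qed (use cd in simp)
    qed
    then show ?thesis
    proof (rule piecewise_chain)
      fix x y z assume "?R x y" "?R y z"
      then show "?R x z" using dist_triangle[of x z y] by linarith
    qed (use ab False in auto)
  qed simp
  note length = path_length_le_of_dist_le[of h "\<lambda>s. 1 / cos \<alpha> * norm (h s - r)", OF dist]
  ultimately show "spiral_arc \<alpha> r h"
    using h length(1) by (simp add: spiral_arc_def)
  show "path_length h \<le> 1 / cos \<alpha> * (norm (pathstart h - r) - norm (pathfinish h - r))"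
    using length(2) by (simp add: pathstart_def pathfinish_def right_diff_distrib)
qed

subsection \<open>Spiral arcs between given points\<close>

text \<open>Following the right spiral until time \<open>s0\<close> and the left one afterwards makes
  \<open>s0 - \<bar>s - s0\<bar>\<close> the angle turned so far, up to the factor \<open>tan \<alpha> * \<tau>\<close>.\<close>

definition spiral_turn :: "real \<Rightarrow> complex \<Rightarrow> complex \<Rightarrow> real \<Rightarrow> real \<Rightarrow> real \<Rightarrow> complex" where
  "spiral_turn k r u \<tau> s0 s = r + (u - r) * exp (Complex (- \<tau> * s) (k * \<tau> * (s0 - \<bar>s - s0\<bar>)))"

text \<open>The right spiral with time t = - ln (1 - s), so that e^(-t) = 1 - s and the infinite
  spiral fits into the unit interval. At \<open>s = 1\<close> the factor \<open>1 - s\<close>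
  vanishes, so the value is \<open>r\<close> whatever \<open>ln 0\<close> is.\<close>

definition spiral_to_root :: "real \<Rightarrow> complex \<Rightarrow> complex \<Rightarrow> real \<Rightarrow> complex" where
  "spiral_to_root k r u s = r + (u - r) * (of_real (1 - s) * cis (- k * ln (1 - s)))"

lemma spiral_eq_exp: "spiral \<beta> r p t = r + (p - r) * exp (Complex (- t) (tan \<beta> * t))"
  by (simp add: spiral_def exp_eq_polar mult_ac)

lemma spiral_turn_arc:
  assumes \<alpha>: "0 < \<alpha>" "\<alpha> < pi / 2" and u: "u \<noteq> r" and \<tau>: "0 < \<tau>" and s0: "0 \<le> s0" "s0 \<le> 1"
  defines "h \<equiv> spiral_turn (tan \<alpha>) r u \<tau> s0"
  shows "spiral_arc \<alpha> r h"
    and "path_length h \<le> 1 / cos \<alpha> * (norm (pathstart h - r) - norm (pathfinish h - r))"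
proof -
  define k where "k = tan \<alpha>"
  have k: "0 < k" using \<alpha> by (simp add: k_def tan_gt_zero)
  have h: "h = (\<lambda>s. r + (u - r) * exp (Complex (- \<tau> * s) (k * \<tau> * (s0 - \<bar>s - s0\<bar>))))"
    by (simp add: h_def k_def spiral_turn_def fun_eq_iff)
  have ne: "h s \<noteq> r" for s using u by (simp add: h)
  have path: "path h"
    unfolding path_def h Complex_eq by (intro continuous_intros)
  have vel: "\<exists>\<sigma> m. \<bar>\<sigma>\<bar> = tan \<alpha> \<and> continuous_on {c..d} m \<and> (\<forall>s\<in>{c..d}. 0 < m s \<and>
        (h has_vector_derivative (r - h s) * (of_real (m s) * Complex 1 \<sigma>)) (at s within {c..d}))"
    if cd: "c < d" "{c<..<d} \<inter> {s0} = {}" for c d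
  proof -
    \<comment> \<open>With \<open>s0\<close> not in the interior, the tent function is affine: of
      slope 1 before \<open>s0\<close> and -1 after it.\<close>
    obtain \<epsilon> e where \<epsilon>: "\<bar>\<epsilon>\<bar> = 1" "\<And>s. s \<in> {c..d} \<Longrightarrow> s0 - \<bar>s - s0\<bar> = \<epsilon> * s + e"
    proof (cases "d \<le> s0")
      case True
      then show ?thesis by (intro that[of 1 0]) auto
    next
      case False
      then have "s0 \<le> c" using cd by auto
      then show ?thesis by (intro that[of "-1" "2 * s0"]) auto
    qed
    have "(h has_vector_derivative (r - h s) * (of_real \<tau> * Complex 1 (- k * \<epsilon>))) (at s within {c..d})"
      if s: "s \<in> {c..d}" for s
    proof (rule has_vector_derivative_transform[OF s])
      define f where "f = (\<lambda>s. s *\<^sub>R Complex (- \<tau>) (k * \<tau> * \<epsilon>) + Complex 0 (k * \<tau> * e))"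
      show h_f: "h x = r + (u - r) * exp (f x)" if "x \<in> {c..d}" for x
      proof -
        have "Complex (- \<tau> * x) (k * \<tau> * (s0 - \<bar>x - s0\<bar>)) = f x"
          unfolding \<epsilon>(2)[OF that] by (simp add: f_def complex_eq_iff algebra_simps)
        then show ?thesis by (simp only: h)
      qed
      have "(f has_vector_derivative Complex (- \<tau>) (k * \<tau> * \<epsilon>)) (at s within {c..d})"
        unfolding f_def by (auto intro!: derivative_eq_intros)
      from has_vector_derivative_exp[OF this]
      have "((\<lambda>x. r + (u - r) * exp (f x)) has_vector_derivative
          0 + (u - r) * (Complex (- \<tau>) (k * \<tau> * \<epsilon>) * exp (f s))) (at s within {c..d})"
        by (intro has_vector_derivative_add has_vector_derivative_const has_vector_derivative_mult_right)
      moreover have "of_real \<tau> * Complex 1 (- k * \<epsilon>) = - Complex (- \<tau>) (k * \<tau> * \<epsilon>)"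
        by (simp add: complex_eq_iff)
      ultimately show "((\<lambda>x. r + (u - r) * exp (f x)) has_vector_derivative
          (r - h s) * (of_real \<tau> * Complex 1 (- k * \<epsilon>))) (at s within {c..d})"
        by (simp add: h_f[OF s] mult_ac)
    qed
    moreover have "\<bar>- k * \<epsilon>\<bar> = tan \<alpha>" using \<epsilon>(1) k by (simp add: abs_mult k_def)
    ultimately show ?thesis
      using \<tau> by (intro exI[of _ "- k * \<epsilon>"] exI[of _ "\<lambda>_. \<tau>"]) auto
  qed
  have seg: "spiral_segment \<alpha> r h c d"
    if cd: "0 \<le> c" "c < d" "{c<..<d} \<inter> {s0} = {}" for c d
  proof (cases "d \<le> s0")
    case True
    show ?thesis
      unfolding spiral_segment_def
    proof (intro exI[of _ u] exI[of _ \<alpha>] exI[of _ "\<lambda>s. \<tau> * s"] conjI ballI)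
      show "h s = spiral \<alpha> r u (\<tau> * s)" if "s \<in> {c..<d}" for s
        using that True by (simp add: h spiral_eq_exp k_def mult_ac)
    qed (use u \<tau> cd in \<open>auto simp: strict_mono_on_def\<close>)
  next
    case False
    then have c: "s0 \<le> c" using cd by auto
    show ?thesis
      unfolding spiral_segment_def
    \<comment> \<open>The left spiral is based at the turning point \<open>h s0\<close>, with time
      counted from there; the exponent splits accordingly.\<close>
    proof (intro exI[of _ "h s0"] exI[of _ "- \<alpha>"] exI[of _ "\<lambda>s. \<tau> * (s - s0)"] conjI ballI)
      show "h s = spiral (- \<alpha>) r (h s0) (\<tau> * (s - s0))" if "s \<in> {c..<d}" for s
      proof -
        have "Complex (- \<tau> * s) (k * \<tau> * (s0 - \<bar>s - s0\<bar>)) = Complex (- \<tau> * s0) (k * \<tau> * s0) +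
            Complex (- (\<tau> * (s - s0))) (- k * (\<tau> * (s - s0)))"
          using that c by (simp add: complex_eq_iff algebra_simps)
        then have "h s = r + (u - r) * exp (Complex (- \<tau> * s0) (k * \<tau> * s0) +
            Complex (- (\<tau> * (s - s0))) (- k * (\<tau> * (s - s0))))"
          by (simp only: h)
        then show ?thesis
          by (simp add: exp_add spiral_eq_exp h k_def mult_ac)
      qed
    qed (use ne \<tau> c in \<open>auto simp: strict_mono_on_def\<close>)
  qed
  show "spiral_arc \<alpha> r h"
    "path_length h \<le> 1 / cos \<alpha> * (norm (pathstart h - r) - norm (pathfinish h - r))"
    using spiral_arcI[OF \<alpha> _ path, of "{s0}" r] ne vel seg by simp_all
qed

lemma spiral_to_root_arc:
  assumes \<alpha>: "0 < \<alpha>" "\<alpha> < pi / 2" and u: "u \<noteq> r"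
  defines "h \<equiv> spiral_to_root (tan \<alpha>) r u"
  shows "spiral_arc \<alpha> r h"
    and "path_length h \<le> 1 / cos \<alpha> * (norm (pathstart h - r) - norm (pathfinish h - r))"
proof -
  define k where "k = tan \<alpha>"
  have k: "0 < k" using \<alpha> by (simp add: k_def tan_gt_zero)
  have h: "h = (\<lambda>s. r + (u - r) * (of_real (1 - s) * cis (- k * ln (1 - s))))"
    by (simp add: h_def k_def spiral_to_root_def fun_eq_iff)
  have ne: "h s \<noteq> r" if "s < 1" for s using u that by (simp add: h)
  have h_exp: "h s = r + (u - r) * exp (ln (1 - s) *\<^sub>R Complex 1 (- k))" if "s < 1" for s
    using that by (simp add: h exp_eq_polar mult.commute[of k])
  have vel: "(h has_vector_derivative (r - h s) * (of_real (1 / (1 - s)) * Complex 1 (- k)))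
      (at s within S)" if s: "s < 1" for s S
  proof -
    have "((\<lambda>x. ln (1 - x)) has_real_derivative - (1 / (1 - s))) (at s)"
      using s by (auto intro!: derivative_eq_intros)
    then have "((\<lambda>x. ln (1 - x) *\<^sub>R Complex 1 (- k)) has_vector_derivative
        - (1 / (1 - s)) *\<^sub>R Complex 1 (- k)) (at s)"
      using has_vector_derivative_scaleR[OF _ has_vector_derivative_const] by fastforce
    from has_vector_derivative_exp[OF this]
    have "((\<lambda>x. r + (u - r) * exp (ln (1 - x) *\<^sub>R Complex 1 (- k))) has_vector_derivative
        0 + (u - r) * (- (1 / (1 - s)) *\<^sub>R Complex 1 (- k) * exp (ln (1 - s) *\<^sub>R Complex 1 (- k)))) (at s)"
      by (intro has_vector_derivative_add has_vector_derivative_const has_vector_derivative_mult_right)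
    moreover have "0 + (u - r) * (- (1 / (1 - s)) *\<^sub>R Complex 1 (- k) * exp (ln (1 - s) *\<^sub>R Complex 1 (- k)))
        = (r - h s) * (of_real (1 / (1 - s)) * Complex 1 (- k))"
      unfolding h_exp[OF s] by (simp add: scaleR_conv_of_real mult_ac)
    ultimately have "((\<lambda>x. r + (u - r) * exp (ln (1 - x) *\<^sub>R Complex 1 (- k))) has_vector_derivative
        (r - h s) * (of_real (1 / (1 - s)) * Complex 1 (- k))) (at s)"
      by simp
    then have "(h has_vector_derivative (r - h s) * (of_real (1 / (1 - s)) * Complex 1 (- k))) (at s)"
      by (rule has_vector_derivative_transform_within_open[of _ _ _ "{..<1}"]) (use s h_exp in auto)
    then show ?thesis by (rule has_vector_derivative_at_within)
  qed
  have path: "path h"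
    unfolding path_def continuous_on_eq_continuous_within
  proof
    fix s :: real assume s: "s \<in> {0..1}"
    show "continuous (at s within {0..1}) h"
    proof (cases "s = 1")
      \<comment> \<open>The velocity formula breaks down at the root. Continuity follows instead
        from \<open>cis\<close> having modulus 1: the distance to \<open>r\<close> is |u - r| |1 -
        s|.\<close>
      case True
      have "((\<lambda>x. h x - r) \<longlongrightarrow> 0) (at s within {0..1})"
      proof (rule Lim_null_comparison)
        show "eventually (\<lambda>x. norm (h x - r) \<le> norm (u - r) * \<bar>1 - x\<bar>) (at s within {0..1})"
          by (simp add: h norm_mult del: of_real_diff)
        have "((\<lambda>x. norm (u - r) * \<bar>1 - x\<bar>) \<longlongrightarrow> norm (u - r) * \<bar>1 - s\<bar>) (at s within {0..1})"
          by (intro tendsto_intros)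
        then show "((\<lambda>x. norm (u - r) * \<bar>1 - x\<bar>) \<longlongrightarrow> 0) (at s within {0..1})"
          using True by simp
      qed
      moreover have "h s = r" using True by (simp add: h)
      ultimately show ?thesis by (simp add: continuous_within LIM_zero_iff)
    qed (use s vel has_vector_derivative_continuous in force)
  qed
  have vel': "\<exists>\<sigma> m. \<bar>\<sigma>\<bar> = tan \<alpha> \<and> continuous_on {c..d} m \<and> (\<forall>s\<in>{c..d}. 0 < m s \<and>
        (h has_vector_derivative (r - h s) * (of_real (m s) * Complex 1 \<sigma>)) (at s within {c..d}))"
    if "d \<le> 1" "h d \<noteq> r" for c d
  proof -
    have "d < 1" using that by (cases "d = 1") (auto simp: h)
    then show ?thesis
      using k vel by (intro exI[of _ "- k"] exI[of _ "\<lambda>s. 1 / (1 - s)"])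
        (auto simp: k_def intro!: continuous_intros simp del: of_real_divide)
  qed
  \<comment> \<open>The case \<open>d = 1\<close> is included: the spiral time is then unbounded,
    and the segment has the limit endpoint \<open>r\<close>.\<close>
  have seg: "spiral_segment \<alpha> r h c d" if cd: "0 \<le> c" "d \<le> 1" for c d
    unfolding spiral_segment_def
  proof (intro exI[of _ u] exI[of _ \<alpha>] exI[of _ "\<lambda>s. - ln (1 - s)"] conjI ballI)
    show "h s = spiral \<alpha> r u (- ln (1 - s))" if "s \<in> {c..<d}" for s
      using that cd by (simp add: h spiral_def k_def mult_ac)
  qed (use u cd in \<open>auto simp: strict_mono_on_def\<close>)
  show "spiral_arc \<alpha> r h"
    "path_length h \<le> 1 / cos \<alpha> * (norm (pathstart h - r) - norm (pathfinish h - r))"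
    using spiral_arcI[OF \<alpha> _ path, of "{}" r] ne vel' seg by simp_all
qed

text \<open>The vanishing term \<open>norm (r - r)\<close> gives the bound the same shape as in
  \<open>ex_spiral_arc\<close>, with \<open>r\<close> for the end point \<open>v\<close>.\<close>

lemma ex_spiral_arc_to_root:
  assumes "0 < \<alpha>" "\<alpha> < pi / 2" "u \<noteq> r"
  shows "\<exists>h. spiral_arc \<alpha> r h \<and> pathstart h = u \<and> pathfinish h = r \<and>
    path_length h \<le> 1 / cos \<alpha> * (norm (u - r) - norm (r - r))"
proof -
  have "pathstart (spiral_to_root (tan \<alpha>) r u) = u" "pathfinish (spiral_to_root (tan \<alpha>) r u) = r"
    by (simp_all add: spiral_to_root_def pathstart_def pathfinish_def)
  then show ?thesis
    using spiral_to_root_arc[OF assms] by metis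
qed

lemma ex_spiral_arc:
  assumes \<alpha>: "0 < \<alpha>" "\<alpha> < pi / 2" and u: "u \<noteq> r" and reach: "spirally_reaches (tan \<alpha>) r u v"
  shows "\<exists>h. spiral_arc \<alpha> r h \<and> pathstart h = u \<and> pathfinish h = v \<and>
    path_length h \<le> 1 / cos \<alpha> * (norm (u - r) - norm (v - r))"
proof -
  obtain z where z: "v - r = (u - r) * exp z" "Re z < 0" "\<bar>Im z\<bar> \<le> - tan \<alpha> * Re z"
    using reach unfolding spirally_reaches_def by auto
  have k: "0 < tan \<alpha>" using \<alpha> by (simp add: tan_gt_zero)
  define \<tau> where "\<tau> = - Re z"
  \<comment> \<open>At time 1 the total turn is \<open>tan \<alpha> * \<tau> * (2 * s0 - 1)\<close>;
    equating it with \<open>Im z\<close> gives \<open>s0\<close>. The cone condition on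
    \<open>z\<close> places \<open>s0\<close> between 0 and 1.\<close>
  define s0 where "s0 = (1 + Im z / (tan \<alpha> * \<tau>)) / 2"
  have \<tau>: "0 < \<tau>" "\<bar>Im z\<bar> \<le> tan \<alpha> * \<tau>" using z by (auto simp: \<tau>_def)
  have "0 < tan \<alpha> * \<tau>" using k \<tau>(1) by simp
  then have "- 1 \<le> Im z / (tan \<alpha> * \<tau>)" "Im z / (tan \<alpha> * \<tau>) \<le> 1"
    using \<tau>(2) by (simp_all only: le_divide_eq divide_le_eq if_True)
  then have s0: "0 \<le> s0" "s0 \<le> 1" by (simp_all add: s0_def)
  have "tan \<alpha> * \<tau> * (2 * s0 - 1) = Im z"
    using k \<tau> by (simp add: s0_def add_divide_distrib)
  then have "Complex (- \<tau> * 1) (tan \<alpha> * \<tau> * (s0 - \<bar>1 - s0\<bar>)) = z"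
    using s0 by (simp add: \<tau>_def complex_eq_iff)
  then have "pathfinish (spiral_turn (tan \<alpha>) r u \<tau> s0) = v"
    unfolding pathfinish_def spiral_turn_def using z(1)[symmetric] by simp
  moreover have "pathstart (spiral_turn (tan \<alpha>) r u \<tau> s0) = u"
    using s0 by (simp add: pathstart_def spiral_turn_def Complex_eq)
  ultimately show ?thesis
    using spiral_turn_arc[OF \<alpha> u \<tau>(1) s0] by metis
qed

subsection \<open>Trees\<close>

lemma ex_spiral_tree:
  assumes \<alpha>: "0 < \<alpha>" "\<alpha> < pi / 2" and T: "flux_tree \<alpha> r X T"
  shows "\<exists>U. spiral_tree \<alpha> r X U \<and> tree_length U \<le> 1 / cos \<alpha> * tree_length T"
proof -
  have cos: "0 < cos \<alpha>" using \<alpha> by (simp add: cos_gt_zero)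
  have tree: "tree_rooted_at r T" and X: "X \<subseteq> nodes T"
    using T by (simp_all add: flux_tree_def)
  have "\<exists>h. spiral_arc \<alpha> r h \<and> pathstart h = pathstart g \<and> pathfinish h = pathfinish g \<and>
      path_length h \<le> 1 / cos \<alpha> * path_length g" if g: "g \<in> arcs T" for g
  proof -
    let ?u = "pathstart g" and ?v = "pathfinish g"
    have g': "path g" "?u \<noteq> r" "rectifiable g" "piecewise_smooth_away_from r g" "angle_restricted \<alpha> r g"
      using T g by (auto simp: flux_tree_def tree_rooted_at_def)
    obtain h where h: "spiral_arc \<alpha> r h" "pathstart h = ?u" "pathfinish h = ?v"
      "path_length h \<le> 1 / cos \<alpha> * (norm (?u - r) - norm (?v - r))"
    proof (cases "?v = r")
      case True
      then show ?thesis using ex_spiral_arc_to_root[OF \<alpha> g'(2)] that by metis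
    next
      case False
      show ?thesis
        using ex_spiral_arc[OF \<alpha> g'(2) arc_spirally_reaches[OF g'(1,4,5) \<alpha> False]] that by metis
    qed
    have "norm (?u - r) - norm (?v - r) \<le> dist ?u ?v"
      using norm_triangle_ineq2[of "?u - r" "?v - r"] by (simp add: dist_norm)
    also have "\<dots> \<le> path_length g" by (rule dist_endpoints_le_path_length[OF g'(3)])
    finally have "1 / cos \<alpha> * (norm (?u - r) - norm (?v - r)) \<le> 1 / cos \<alpha> * path_length g"
      using cos by (intro mult_left_mono) auto
    then show ?thesis using h by (intro exI[of _ h]) auto
  qed
  then obtain A where A: "\<And>g. g \<in> arcs T \<Longrightarrow> spiral_arc \<alpha> r (A g)"
    "\<And>g. g \<in> arcs T \<Longrightarrow> pathstart (A g) = pathstart g"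
    "\<And>g. g \<in> arcs T \<Longrightarrow> pathfinish (A g) = pathfinish g"
    "\<And>g. g \<in> arcs T \<Longrightarrow> path_length (A g) \<le> 1 / cos \<alpha> * path_length g"
    by metis
  define U where "U = \<lparr>nodes = nodes T, arcs = A ` arcs T\<rparr>"
  have U: "nodes U = nodes T" "arcs U = A ` arcs T" by (simp_all add: U_def)
  \<comment> \<open>Every node other than \<open>r\<close> has a unique outgoing arc, so arcs are
    determined by their start points. As \<open>A\<close> preserves these, it is injective, and the
    length of \<open>U\<close> can be summed over the arcs of \<open>T\<close>.\<close>
  have start_inj: "g = g'" if "g \<in> arcs T" "g' \<in> arcs T" "pathstart g = pathstart g'" for g g'
  proof -
    have "pathstart g \<in> nodes T - {r}" using tree that by (auto simp: tree_rooted_at_def)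
    then show ?thesis using tree that unfolding tree_rooted_at_def by metis
  qed
  then have inj: "inj_on A (arcs T)" using A(2) by (metis inj_onI)
  have "tree_rooted_at r U"
    unfolding tree_rooted_at_def U
  proof (intro conjI)
    show "\<forall>v\<in>nodes T - {r}. \<exists>!g. g \<in> A ` arcs T \<and> pathstart g = v"
    proof
      fix v assume "v \<in> nodes T - {r}"
      then obtain g where g: "g \<in> arcs T" "pathstart g = v"
        using tree unfolding tree_rooted_at_def by metis
      show "\<exists>!g. g \<in> A ` arcs T \<and> pathstart g = v"
      proof (rule ex1I[of _ "A g"])
        fix h assume "h \<in> A ` arcs T \<and> pathstart h = v"
        then obtain g' where "g' \<in> arcs T" "h = A g'" "pathstart g' = v" using A(2) by auto
        then show "h = A g" using start_inj g by metis
      qed (use g A(2) in auto)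
    qed
    \<comment> \<open>\<open>A\<close> preserves end points, so the edge relation, and with it
      reachability of the root, is unchanged.\<close>
    have "{(pathstart g, pathfinish g) | g. g \<in> A ` arcs T} = {(pathstart g, pathfinish g) | g. g \<in> arcs T}"
      using A(2,3) by (auto simp: image_iff) metis+
    then show "\<forall>v\<in>nodes T. (v, r) \<in> {(pathstart g, pathfinish g) | g. g \<in> A ` arcs T}\<^sup>*"
      using tree by (simp add: tree_rooted_at_def)
    show "\<forall>g\<in>A ` arcs T. path g \<and> pathstart g \<in> nodes T \<and> pathfinish g \<in> nodes T"
      using tree A(1-3) by (auto simp: tree_rooted_at_def spiral_arc_def)
    show "\<forall>g\<in>A ` arcs T. pathstart g \<noteq> r"
      using tree A(2) by (auto simp: tree_rooted_at_def)
  qed (use tree in \<open>auto simp: tree_rooted_at_def\<close>)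
  then have "spiral_tree \<alpha> r X U"
    using X A(1) by (auto simp: spiral_tree_def flux_tree_def U spiral_arc_def)
  moreover have "tree_length U \<le> 1 / cos \<alpha> * tree_length T"
    unfolding tree_length_def U sum.reindex[OF inj] sum_distrib_left
    using A(4) by (intro sum_mono) simp
  ultimately show ?thesis by blast
qed

theorem theorem1:
  fixes r :: complex and t :: "nat \<Rightarrow> complex" and n :: nat and \<alpha> :: real
    and T T' :: plane_tree
  assumes "0 < \<alpha>" and "\<alpha> < pi / 2"
    and "optimal_flux_tree \<alpha> r (t ` {1..n}) T"
    and "optimal_spiral_tree \<alpha> r (t ` {1..n}) T'"
  shows "tree_length T' \<le> (1 / cos \<alpha>) * tree_length T"
proof -
  obtain U where "spiral_tree \<alpha> r (t ` {1..n}) U" "tree_length U \<le> 1 / cos \<alpha> * tree_length T"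
    using ex_spiral_tree[OF assms(1,2)] assms(3) unfolding optimal_flux_tree_def by blast
  then show ?thesis
    using assms(4) unfolding optimal_spiral_tree_def by force
qed

end
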